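(* Let $K$ be an isolated invariant continuum of a flow on the plane $\mathbb{R}^2$. Suppose that $\mathbb{R}^{2}-K$ has $i$ connected components. Then there are at least $i-1$ fixed points in $\mathbb{R}^{2}-K$.
   Context: A flow on $\mathbb{R}^2$ is a continuous action $\varphi:\mathbb{R}^2\times\mathbb{R}\to\mathbb{R}^2$. A continuum is a compact connected set. An isolated invariant set is a non-empty compact invariant set $K$ having an isolating neighborhood, i.e. a compact neighborhood $N$ such that $K$ is the maximal invariant set in $N$. *)

theory Defs
  imports "HOL-Analysis.Analysis"
begin

definition is_flow :: "('a::topological_space \<times> real \<Rightarrow> 'a) \<Rightarrow> bool" where
  "is_flow \<phi> \<longleftrightarrow>
     continuous_on UNIV \<phi> \<and>
     (\<forall>x. \<phi> (x, 0) = x) \<and>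
     (\<forall>x s t. \<phi> (\<phi> (x, s), t) = \<phi> (x, s + t))"

definition flow_invariant :: "('a::topological_space \<times> real \<Rightarrow> 'a) \<Rightarrow> 'a set \<Rightarrow> bool" where
  "flow_invariant \<phi> S \<longleftrightarrow> \<phi> ` (S \<times> UNIV) = S"

definition isolating_neighborhood ::
  "('a::topological_space \<times> real \<Rightarrow> 'a) \<Rightarrow> 'a set \<Rightarrow> 'a set \<Rightarrow> bool" where
  "isolating_neighborhood \<phi> K N \<longleftrightarrow>
     compact N \<and> K \<subseteq> interior N \<and>
     flow_invariant \<phi> K \<and> (\<forall>S. S \<subseteq> N \<and> flow_invariant \<phi> S \<longrightarrow> S \<subseteq> K)"

definition isolated_invariant_set :: "('a::topological_space \<times> real \<Rightarrow> 'a) \<Rightarrow> 'a set \<Rightarrow> bool" where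
  "isolated_invariant_set \<phi> K \<longleftrightarrow>
     K \<noteq> {} \<and> compact K \<and> flow_invariant \<phi> K \<and> (\<exists>N. isolating_neighborhood \<phi> K N)"

definition continuum :: "'a::topological_space set \<Rightarrow> bool" where
  "continuum K \<longleftrightarrow> compact K \<and> connected K"

definition fixed_points :: "('a::topological_space \<times> real \<Rightarrow> 'a) \<Rightarrow> 'a set" where
  "fixed_points \<phi> = {x. \<forall>t. \<phi> (x, t) = x}"

end

theory Submission
  imports Defs "HOL-Complex_Analysis.Riemann_Mapping"
begin

text \<open>
A fixed point is found in every bounded component \<open>U\<close> of the complement of the continuum \<open>K\<close>;
at most one component is unbounded, so this gives the bound. Two properties of \<open>U\<close> are
used. Its complement is connected, so \<open>U\<close> is simply connected. And because \<open>K\<close> is isolated, the part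
of the closure of \<open>U\<close> outside the interior of an isolating neighborhood is a compact subset \<open>B\<close> of \<open>U\<close>
that every orbit in \<open>U\<close> visits: an orbit that stays away from \<open>B\<close> stays in the isolating
neighborhood and would belong to \<open>K\<close>. Without isolation the conclusion fails, since the orbits in
\<open>U\<close> could all be loops based at one fixed point of \<open>K\<close>.

Suppose that \<open>U\<close> contains no fixed point, and write \<open>F t\<close> for the time \<open>t\<close> map.

No recurrence. By compactness of \<open>B\<close>, no point of \<open>U\<close> has a small period, so for small \<open>s\<close> the
displacement \<open>F s z - z\<close> has no zero on \<open>U\<close>, and it has a continuous logarithm there, as \<open>U\<close> is simply
connected. Along a periodic orbit the displacement is a secant of a simple closed
curve, and Hopf's argument for the theorem on turning tangents shows that such a field winds an odd
number of times; so it has no continuous logarithm along the curve (\<open>no_log_of_field_along_loop\<close>),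
and there are no periodic orbits. An orbit that came back very close to itself would, after being closed
by a short segment, give the same contradiction (\<open>no_return\<close>). Hence orbits leave every compact
subset of \<open>U\<close> in both time directions.

Separation. It follows that the two halves of an orbit, each united with the complement of \<open>U\<close>,
are closed connected sets that meet in the complement of \<open>U\<close> and one further point. By
Janiszewski's theorem on the sphere their union separates, that is, each orbit cuts \<open>U\<close> into
at least two pieces, which are called sides here (\<open>orbit_separates\<close>).

Minimality. Every side contains a strictly smaller side, of any orbit inside it. On
the other hand every decreasing chain of sides has a lower bound: all of them meet the compact set \<open>B\<close>,
so their closures have a common point \<open>y\<close> in \<open>B\<close>, and some side of the orbit of \<open>y\<close> lies inside all
members of the chain. Zorn's lemma yields a minimal side, which is absurd (\<open>contradiction\<close>).
\<close>

section \<open>Fields along simple loops\<close>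

lemma constant_on_if_exp_eq_1:
  fixes f :: "'a::topological_space \<Rightarrow> complex"
  assumes "connected S" and contf: "continuous_on S f" and exp1: "\<And>x. x \<in> S \<Longrightarrow> exp (f x) = 1"
  shows "f constant_on S"
proof (rule continuous_discrete_range_constant [OF \<open>connected S\<close> contf])
  fix x assume x: "x \<in> S"
  have "1 \<le> norm (f y - f x)" if y: "y \<in> S" "f y \<noteq> f x" for y
  proof -
    have "exp (f y - f x) = 1"
      using exp1 x y by (simp add: exp_diff)
    then obtain n :: int where n: "Re (f y - f x) = 0" "Im (f y - f x) = of_int (2 * n) * pi"
      unfolding exp_eq_1 by blast
    have "n \<noteq> 0"
      using n y by (auto simp: complex_eq_iff)
    then have "1 \<le> \<bar>real_of_int n\<bar>"
      by linarith
    then have "1 * 1 \<le> (2 * \<bar>real_of_int n\<bar>) * pi"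
      using pi_gt3 by (intro mult_mono) auto
    also have "\<dots> = \<bar>Im (f y - f x)\<bar>"
      by (simp only: n(2)) (simp add: abs_mult)
    also have "\<dots> \<le> norm (f y - f x)"
      by (rule abs_Im_le_cmod)
    finally show ?thesis by simp
  qed
  then show "\<exists>e>0. \<forall>y. y \<in> S \<and> f y \<noteq> f x \<longrightarrow> e \<le> norm (f y - f x)"
    by (intro exI[of _ 1]) auto
qed

text \<open>
The quotient of two fields that are close to each other stays in the right half-plane, where the
principal logarithm is continuous; what remains is continuous with values in the multiples of \<open>2 \<pi> \<i>\<close>.
\<close>
lemma log_difference_constant_on:
  fixes h k :: "'a::topological_space \<Rightarrow> complex"
  assumes "connected S" and cont: "continuous_on S h" "continuous_on S k"
    and close: "\<And>x. x \<in> S \<Longrightarrow> norm (exp (h x) - exp (k x)) < norm (exp (k x))"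
  shows "(\<lambda>x. h x - k x - Ln (exp (h x) / exp (k x))) constant_on S"
proof (rule constant_on_if_exp_eq_1 [OF \<open>connected S\<close>])
  have pos: "exp (h x) / exp (k x) \<notin> \<real>\<^sub>\<le>\<^sub>0" if "x \<in> S" for x
  proof
    assume *: "exp (h x) / exp (k x) \<in> \<real>\<^sub>\<le>\<^sub>0"
    have "norm (exp (h x) / exp (k x) - 1) < 1"
      using close[OF that] by (simp add: divide_simps norm_divide flip: norm_divide)
        (simp add: norm_divide)
    moreover have "1 \<le> \<bar>Re (exp (h x) / exp (k x) - 1)\<bar>"
      using * by (auto simp: complex_nonpos_Reals_iff)
    ultimately show False
      using abs_Re_le_cmod[of "exp (h x) / exp (k x) - 1"] by linarith
  qed
  show "continuous_on S (\<lambda>x. h x - k x - Ln (exp (h x) / exp (k x)))"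
    by (intro continuous_intros cont) (use pos in auto)
  show "exp (h x - k x - Ln (exp (h x) / exp (k x))) = 1" if "x \<in> S" for x
    by (simp add: exp_diff)
qed

text \<open>
This is the winding number part of Hopf's proof that the tangent of a simple closed curve turns
once. The field \<open>f\<close> along the loop \<open>\<gamma>\<close> is compared with secants \<open>\<gamma> v - \<gamma> u\<close>. On the triangle
\<open>u < v\<close> the secant has a continuous logarithm \<open>h\<close>. Exchanging the roles of the end points of a secant
starting in \<open>\<gamma> 0 = \<gamma> L\<close> identifies the edge points \<open>(0, v)\<close> and \<open>(v, L)\<close> and changes the sign of the
secant, so it changes \<open>h\<close> by a constant \<open>c\<close> with \<open>exp c = -1\<close>. Following \<open>f\<close> once around the loop
passes this identification twice, in the same direction, so that a logarithm of \<open>f\<close> would change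
by \<open>2 c\<close>, which is not zero.

The parameter \<open>T\<close> separates the part \<open>[0, T]\<close> of the loop, on which the
field is about the secant to the point that is \<open>s\<close> ahead, from a part \<open>[T, L]\<close> so short
that it looks like a single point on the scale of \<open>f\<close>. The four closeness assumptions concern, in this
order, the secants before, while and after the front end crosses the short part, and while the rear end
crosses it.
\<close>
lemma no_log_of_field_along_loop:
  fixes \<gamma> f g :: "real \<Rightarrow> complex" and L T s :: real
  assumes s: "0 < s" "s < T" "T \<le> L"
    and cont: "continuous_on {0..L} \<gamma>"
    and closed: "\<gamma> L = \<gamma> 0"
    and simple: "\<And>u v. \<lbrakk>0 \<le> u; u < v; v \<le> L; \<gamma> u = \<gamma> v\<rbrakk> \<Longrightarrow> u = 0 \<and> v = L"
    and contg: "continuous_on {0..L} g" and gL: "g L = g 0"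
    and g: "\<And>u. \<lbrakk>0 \<le> u; u \<le> L\<rbrakk> \<Longrightarrow> exp (g u) = f u"
    and near1: "\<And>u. \<lbrakk>0 \<le> u; u \<le> T - s\<rbrakk> \<Longrightarrow> norm (\<gamma> (u + s) - \<gamma> u - f u) < norm (f u)"
    and near2: "\<And>v. \<lbrakk>T \<le> v; v \<le> L\<rbrakk> \<Longrightarrow> norm (\<gamma> v - \<gamma> (T - s) - f (T - s)) < norm (f (T - s))"
    and near3: "\<And>u. \<lbrakk>T - s \<le> u; u \<le> T\<rbrakk> \<Longrightarrow> norm (\<gamma> (u + s - T) - \<gamma> u - f u) < norm (f u)"
    and near4: "\<And>u. \<lbrakk>T \<le> u; u \<le> L\<rbrakk> \<Longrightarrow> norm (\<gamma> s - \<gamma> u - f u) < norm (f u)"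
  shows False
proof -
  (* The corner (0, L) is removed because the secant vanishes there; it is an extreme point,
     so convexity survives. *)
  define \<Delta> where "\<Delta> = {p :: real \<times> real. 0 \<le> fst p \<and> fst p < snd p \<and> snd p \<le> L \<and> p \<noteq> (0, L)}"
  have "convex \<Delta>"
  proof (rule convexI)
    fix p q :: "real \<times> real" and a b :: real
    assume p: "p \<in> \<Delta>" and q: "q \<in> \<Delta>" and ab: "0 \<le> a" "0 \<le> b" "a + b = 1"
    show "a *\<^sub>R p + b *\<^sub>R q \<in> \<Delta>"
    proof (cases "a = 0 \<or> b = 0")
      case True
      then show ?thesis using p q ab by auto
    next
      case False
      then have pos: "0 < a" "0 < b" using ab by auto
      obtain u v u' v' where uv: "p = (u, v)" "q = (u', v')"
        by (metis surj_pair)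
      have 1: "0 \<le> u" "u < v" "v \<le> L" "0 < u \<or> v < L" "0 \<le> u'" "u' < v'" "v' \<le> L"
        using p q by (auto simp: uv \<Delta>_def)
      have "a * u + b * u' < a * v + b * v'"
        using 1 pos by (intro add_strict_mono) auto
      moreover have "a * v + b * v' \<le> a * L + b * L"
        using 1 pos by (intro add_mono) auto
      moreover have "0 < a * u + b * u' \<or> a * v + b * v' < a * L + b * L"
        using 1 pos by (metis add_less_le_mono add_pos_nonneg mult_le_cancel_left_pos
            mult_less_cancel_left_pos mult_pos_pos mult_nonneg_nonneg less_imp_le)
      moreover have "a * L + b * L = L"
        using ab by (metis distrib_right mult_1)
      moreover have "0 \<le> a * u + b * u'"
        using 1 pos by simp
      ultimately show ?thesis
        by (auto simp: uv \<Delta>_def)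
    qed
  qed
  then have "contractible \<Delta>"
    by (rule convex_imp_contractible)
  have cont_sec: "continuous_on \<Delta> (\<lambda>p. \<gamma> (snd p) - \<gamma> (fst p))"
    by (intro continuous_intros continuous_on_compose2[OF cont]) (auto simp: \<Delta>_def)
  have nz: "\<gamma> (snd p) - \<gamma> (fst p) \<noteq> 0" if "p \<in> \<Delta>" for p
    using that simple[of "fst p" "snd p"] by (auto simp: \<Delta>_def prod_eq_iff)
  obtain h where conth: "continuous_on \<Delta> h"
    and h: "\<And>p. p \<in> \<Delta> \<Longrightarrow> \<gamma> (snd p) - \<gamma> (fst p) = exp (h p)"
    using continuous_logarithm_on_contractible[OF cont_sec \<open>contractible \<Delta>\<close> nz] by metis
  have "(\<lambda>v. h (v, L) - h (0, v) - \<i> * pi) constant_on {0<..<L}"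
  proof (rule constant_on_if_exp_eq_1)
    show "continuous_on {0<..<L} (\<lambda>v. h (v, L) - h (0, v) - \<i> * pi)"
      by (intro continuous_intros continuous_on_compose2[OF conth]) (auto simp: \<Delta>_def)
    show "exp (h (v, L) - h (0, v) - \<i> * pi) = 1" if "v \<in> {0<..<L}" for v
    proof -
      have "(v, L) \<in> \<Delta>" "(0, v) \<in> \<Delta>"
        using that by (auto simp: \<Delta>_def)
      then have "exp (h (v, L)) = - exp (h (0, v))"
        using h[of "(v, L)"] h[of "(0, v)"] closed by (metis fst_conv snd_conv minus_diff_eq)
      then show ?thesis
        by (simp add: exp_diff)
    qed
  qed auto
  then obtain d where d: "\<And>v. v \<in> {0<..<L} \<Longrightarrow> h (v, L) - h (0, v) - \<i> * pi = d"
    by (auto simp: constant_on_def)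
  define c where "c = d + \<i> * pi"
  have c: "h (v, L) = h (0, v) + c" if "0 < v" "v < L" for v
    using d[of v] that by (simp add: c_def algebra_simps)
  have expc: "exp c = -1"
  proof -
    have "(s, L) \<in> \<Delta>" "(0, s) \<in> \<Delta>"
      using s by (auto simp: \<Delta>_def)
    then have "exp (h (s, L)) = - exp (h (0, s))"
      using h[of "(s, L)"] h[of "(0, s)"] closed by (metis fst_conv snd_conv minus_diff_eq)
    moreover have "exp (h (s, L)) = exp (h (0, s)) * exp c"
      using c[of s] s by (simp add: exp_add)
    ultimately show ?thesis
      by (metis exp_not_eq_zero mult_cancel_left mult_minus1_right)
  qed
  (* The pairs of end points of the secants that follow f around the loop. P2 starts when the
     front end passes gamma L = gamma 0; from there on the front end is the smaller parameter. *)
  define P1 where "P1 = (\<lambda>u. (u, u + s)) ` {0..T - s} \<union> (\<lambda>v. (T - s, v)) ` {T..L}"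
  define P2 where "P2 = (\<lambda>u. (u + s - T, u)) ` {T - s..T} \<union> (\<lambda>u. (s, u)) ` {T..L}"
  have P\<Delta>: "P1 \<subseteq> \<Delta>" "P2 \<subseteq> \<Delta>"
    using s by (auto simp: P1_def P2_def \<Delta>_def)
  have conn1: "connected P1"
    unfolding P1_def
  proof (rule connected_Un)
    show "(\<lambda>u. (u, u + s)) ` {0..T - s} \<inter> (\<lambda>v. (T - s, v)) ` {T..L} \<noteq> {}"
    proof -
      have "(T - s, T) \<in> (\<lambda>u. (u, u + s)) ` {0..T - s}" "(T - s, T) \<in> (\<lambda>v. (T - s, v)) ` {T..L}"
        using s by (intro image_eqI[of _ _ "T - s"] image_eqI[of _ _ T]; simp)+
      then show ?thesis by blast
    qed
  qed (intro connected_continuous_image continuous_intros; simp)+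
  have conn2: "connected P2"
    unfolding P2_def
  proof (rule connected_Un)
    show "(\<lambda>u. (u + s - T, u)) ` {T - s..T} \<inter> (\<lambda>u. (s, u)) ` {T..L} \<noteq> {}"
    proof -
      have "(s, T) \<in> (\<lambda>u. (u + s - T, u)) ` {T - s..T}" "(s, T) \<in> (\<lambda>u. (s, u)) ` {T..L}"
        using s by (intro image_eqI[of _ _ T]; simp)+
      then show ?thesis by blast
    qed
  qed (intro connected_continuous_image continuous_intros; simp)+
  have P1_bounds: "0 \<le> fst p" "fst p \<le> L" if "p \<in> P1" for p
    using that s by (auto simp: P1_def)
  have P2_bounds: "0 \<le> snd p" "snd p \<le> L" if "p \<in> P2" for p
    using that s by (auto simp: P2_def)
  (* Each is constant along its path. The paths are joined by exchanging the end points of the secant: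
     E1 and E2 agree when (T - s, L) becomes (0, T - s), but differ by 2 c when (s, L) becomes (0, s). *)
  define E1 where "E1 = (\<lambda>p. h p - g (fst p) - Ln (exp (h p) / exp (g (fst p))))"
  define E2 where "E2 = (\<lambda>p. (h p + c) - g (snd p) - Ln (exp (h p + c) / exp (g (snd p))))"
  have "E1 constant_on P1"
    unfolding E1_def
  proof (rule log_difference_constant_on [OF conn1])
    show "continuous_on P1 h"
      using P\<Delta> conth continuous_on_subset by blast
    show "continuous_on P1 (\<lambda>p. g (fst p))"
      by (intro continuous_on_compose2[OF contg] continuous_intros) (use P1_bounds in auto)
    fix p assume p: "p \<in> P1"
    have 1: "exp (h p) = \<gamma> (snd p) - \<gamma> (fst p)"
      using h p P\<Delta> by force
    have 2: "exp (g (fst p)) = f (fst p)"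
      using g P1_bounds[OF p] by blast
    show "norm (exp (h p) - exp (g (fst p))) < norm (exp (g (fst p)))"
      unfolding 1 2 using p near1 near2 by (auto simp: P1_def)
  qed
  moreover have "E2 constant_on P2"
    unfolding E2_def
  proof (rule log_difference_constant_on [OF conn2])
    show "continuous_on P2 (\<lambda>p. h p + c)"
      using P\<Delta> conth continuous_on_subset by (intro continuous_intros) blast
    show "continuous_on P2 (\<lambda>p. g (snd p))"
      by (intro continuous_on_compose2[OF contg] continuous_intros) (use P2_bounds in auto)
    fix p assume p: "p \<in> P2"
    have 1: "exp (h p + c) = \<gamma> (fst p) - \<gamma> (snd p)"
    proof -
      have "exp (h p) = \<gamma> (snd p) - \<gamma> (fst p)"
        using h p P\<Delta> by force
      then show ?thesis
        by (simp add: exp_add expc)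
    qed
    have 2: "exp (g (snd p)) = f (snd p)"
      using g P2_bounds[OF p] by blast
    show "norm (exp (h p + c) - exp (g (snd p))) < norm (exp (g (snd p)))"
      unfolding 1 2 using p near3 near4 by (auto simp: P2_def)
  qed
  moreover have "(0, s) \<in> P1" "(T - s, L) \<in> P1" "(0, T - s) \<in> P2" "(s, L) \<in> P2"
    using s by (auto simp: P1_def P2_def image_iff)
  ultimately have E: "E1 (T - s, L) = E1 (0, s)" "E2 (s, L) = E2 (0, T - s)"
    unfolding constant_on_def by metis+
  have "E1 (T - s, L) = E2 (0, T - s)"
    using c[of "T - s"] s by (simp add: E1_def E2_def)
  moreover have "E2 (s, L) = E1 (0, s) + 2 * c"
    using c[of s] s by (simp add: E1_def E2_def gL exp_add expc)
  ultimately have "c = 0"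
    using E by simp
  then show False
    using expc by simp
qed

section \<open>Connected sets in the plane and on the sphere\<close>

text \<open>
The inversion at a point \<open>p\<close> moves closed unbounded sets that avoid \<open>p\<close> to compact sets: \<open>0\<close> plays
the role of the point at infinity. This carries theorems about plane continua over to the sphere.
\<close>
lemma compact_inversion:
  fixes p :: complex
  assumes "closed A" "p \<notin> A"
  shows "compact (insert 0 ((\<lambda>z. inverse (z - p)) ` A))" (is "compact ?S")
proof -
  have "continuous_on (- {0}) (\<lambda>w. p + inverse w)"
    by (intro continuous_intros) auto
  then have "open {w \<in> - {0}. p + inverse w \<in> - A}"
    using continuous_open_preimage[of "- {0}" "\<lambda>w. p + inverse w" "- A"] \<open>closed A\<close>
    by (simp add: vimage_def Int_def open_Compl)
  moreover have "- ?S = {w \<in> - {0}. p + inverse w \<in> - A}"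
  proof (intro set_eqI iffI)
    fix w assume "w \<in> - ?S"
    then show "w \<in> {w \<in> - {0}. p + inverse w \<in> - A}"
      by (auto simp: image_iff dest!: bspec[of _ _ "p + inverse w"])
  next
    fix w assume w: "w \<in> {w \<in> - {0}. p + inverse w \<in> - A}"
    show "w \<in> - ?S"
    proof
      assume "w \<in> ?S"
      then obtain z where "z \<in> A" "w = inverse (z - p)"
        using w by auto
      then show False using w by auto
    qed
  qed
  ultimately have "closed ?S"
    by (simp add: closed_def)
  moreover have "bounded ?S"
  proof -
    obtain e where e: "e > 0" "ball p e \<subseteq> - A"
      using assms by (meson ComplI open_Compl open_contains_ball)
    have "norm (inverse (z - p)) \<le> inverse e" if "z \<in> A" for z
    proof -
      have "e \<le> norm (z - p)"
        using e(2) that by (force simp: dist_norm norm_minus_commute)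
      then show ?thesis
        using e(1) by (simp add: norm_inverse le_imp_inverse_le)
    qed
    then have "bounded ((\<lambda>z. inverse (z - p)) ` A)"
      unfolding bounded_iff by blast
    then show ?thesis by simp
  qed
  ultimately show ?thesis
    by (simp add: compact_eq_bounded_closed)
qed

lemma connected_inversion:
  fixes p :: complex
  assumes "connected A" "p \<notin> A" "\<not> bounded A"
  shows "connected (insert 0 ((\<lambda>z. inverse (z - p)) ` A))"
proof (rule connected_intermediate_closure)
  show "connected ((\<lambda>z. inverse (z - p)) ` A)"
    using assms by (intro connected_continuous_image continuous_intros) auto
  have "0 \<in> closure ((\<lambda>z. inverse (z - p)) ` A)"
    unfolding closure_approachable
  proof (intro allI impI)
    fix e :: real assume "0 < e"
    obtain z where z: "z \<in> A" "\<not> dist p z \<le> inverse e"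
      using \<open>\<not> bounded A\<close> unfolding bounded_any_center[of A p] by blast
    then have "norm (inverse (z - p)) < inverse (inverse e)"
      using \<open>0 < e\<close> by (simp only: norm_inverse) (intro less_imp_inverse_less; simp add: dist_norm norm_minus_commute)
    then show "\<exists>y\<in>(\<lambda>z. inverse (z - p)) ` A. dist y 0 < e"
      using z by auto
  qed
  then show "insert 0 ((\<lambda>z. inverse (z - p)) ` A) \<subseteq> closure ((\<lambda>z. inverse (z - p)) ` A)"
    using closure_subset[of "(\<lambda>z. inverse (z - p)) ` A"] by simp
qed auto

text \<open>
Two continua on the sphere whose union does not separate have a connected intersection. When both contain
the point at infinity, this says that their intersection has no part that is compact in the plane and
split off from the rest. The proof moves a point outside of both sets to infinity, which leaves the
complement of the union connected.
\<close>
lemma Janiszewski_dual_unbounded: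
  fixes A B C D :: "complex set"
  assumes A: "closed A" "connected A" "\<not> bounded A"
    and B: "closed B" "connected B" "\<not> bounded B"
    and AB: "A \<union> B \<noteq> UNIV" "connected (- (A \<union> B))"
    and CD: "A \<inter> B = C \<union> D" "C \<inter> D = {}" "compact C" "closed D"
  shows "C = {}"
proof (rule ccontr)
  assume "C \<noteq> {}"
  obtain p where p: "p \<notin> A" "p \<notin> B"
    using AB(1) by blast
  define \<iota> where "\<iota> = (\<lambda>z. inverse (z - p))"
  have inj: "\<iota> z = \<iota> w \<longleftrightarrow> z = w" for z w
    by (simp add: \<iota>_def)
  have \<iota>0: "\<iota> z = 0 \<longleftrightarrow> z = p" for z
    by (simp add: \<iota>_def)
  have surj: "\<exists>z. z \<noteq> p \<and> w = \<iota> z" if "w \<noteq> 0" for w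
    using that by (intro exI[of _ "p + inverse w"]) (simp add: \<iota>_def)
  have "connected (- (A \<union> B) - {p})"
    using A B AB by (intro connected_open_delete) auto
  then have "connected (\<iota> ` (- (A \<union> B) - {p}))"
    unfolding \<iota>_def by (intro connected_continuous_image continuous_intros) auto
  also have "\<iota> ` (- (A \<union> B) - {p}) = - (insert 0 (\<iota> ` A) \<union> insert 0 (\<iota> ` B))"
  proof (intro set_eqI iffI)
    fix w assume "w \<in> - (insert 0 (\<iota> ` A) \<union> insert 0 (\<iota> ` B))"
    then show "w \<in> \<iota> ` (- (A \<union> B) - {p})"
      using surj[of w] by blast
  qed (use inj \<iota>0 in auto)
  finally have "connected (insert 0 (\<iota> ` A) \<inter> insert 0 (\<iota> ` B))"
    using p A B unfolding \<iota>_def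
    by (intro Janiszewski_dual compact_inversion connected_inversion) auto
  also have "insert 0 (\<iota> ` A) \<inter> insert 0 (\<iota> ` B) = insert 0 (\<iota> ` A \<inter> \<iota> ` B)"
    by simp
  also have "\<iota> ` A \<inter> \<iota> ` B = \<iota> ` (C \<union> D)"
    unfolding CD(1)[symmetric] using inj by (intro image_Int[symmetric]) (auto intro: injI)
  also have "insert 0 (\<iota> ` (C \<union> D)) = \<iota> ` C \<union> insert 0 (\<iota> ` D)"
    by (simp add: image_Un)
  finally have conn: "connected (\<iota> ` C \<union> insert 0 (\<iota> ` D))" .
  have pCD: "p \<notin> C" "p \<notin> D"
    using CD(1) p by blast+
  have "compact (\<iota> ` C)"
    using CD(3) pCD unfolding \<iota>_def by (intro compact_continuous_image continuous_intros) auto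
  moreover have "compact (insert 0 (\<iota> ` D))"
    using CD(4) pCD unfolding \<iota>_def by (intro compact_inversion)
  moreover have "\<iota> ` C \<inter> insert 0 (\<iota> ` D) = {}"
  proof -
    have "0 \<notin> \<iota> ` C"
      using pCD \<iota>0 by fastforce
    moreover have "\<iota> ` C \<inter> \<iota> ` D = {}"
      using CD(2) by (auto simp: inj)
    ultimately show ?thesis
      by simp
  qed
  ultimately have "\<iota> ` C \<inter> (\<iota> ` C \<union> insert 0 (\<iota> ` D)) = {}
      \<or> insert 0 (\<iota> ` D) \<inter> (\<iota> ` C \<union> insert 0 (\<iota> ` D)) = {}"
    by (intro connected_closedD[OF conn]) (auto dest: compact_imp_closed)
  then show False
    using \<open>C \<noteq> {}\<close> by auto
qed

lemma connected_Union_chain: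
  assumes "\<And>W. W \<in> \<C> \<Longrightarrow> connected W" and chain: "\<And>V W. \<lbrakk>V \<in> \<C>; W \<in> \<C>\<rbrakk> \<Longrightarrow> V \<subseteq> W \<or> W \<subseteq> V"
  shows "connected (\<Union>\<C>)"
  unfolding connected_iff_connected_component
proof (intro ballI)
  fix a b assume "a \<in> \<Union>\<C>" "b \<in> \<Union>\<C>"
  then obtain W where "W \<in> \<C>" "a \<in> W" "b \<in> W"
    using chain by blast
  then show "connected_component (\<Union>\<C>) a b"
    unfolding connected_component_def using assms(1) by blast
qed

section \<open>Flows without fixed points on a disc\<close>

text \<open>
The hypothetical situation that is refuted below: a flow without fixed points on an open disc \<open>U\<close>, all of
whose orbits visit a fixed compact set \<open>B\<close>. The complement of \<open>U\<close> stands for a single ideal boundary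
point, and the assumption on \<open>B\<close> is the trace that the isolation of the boundary leaves inside.
\<close>
locale fixed_point_free_disc_flow =
  fixes F :: "real \<Rightarrow> complex \<Rightarrow> complex" and U B :: "complex set"
  assumes cont: "continuous_on UNIV (\<lambda>p. F (snd p) (fst p))"
    and flow_0 [simp]: "F 0 z = z"
    and flow_add: "F t (F s z) = F (s + t) z"
    and U: "open U" "connected U" "bounded U" "U \<noteq> {}" "connected (- U)"
    and invariant: "z \<in> U \<Longrightarrow> F t z \<in> U"
    and B: "compact B" "B \<subseteq> U"
    and meets_B: "z \<in> U \<Longrightarrow> \<exists>t. F t z \<in> B"
    and no_fixed_point: "z \<in> U \<Longrightarrow> \<exists>t. F t z \<noteq> z"
begin

lemma continuous_on_flow [continuous_intros]:
  assumes "continuous_on S f" "continuous_on S g"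
  shows "continuous_on S (\<lambda>x. F (f x) (g x))"
  using continuous_on_compose2[OF cont, of S "\<lambda>x. (g x, f x)"] assms
  by (auto intro!: continuous_intros)

lemma tendsto_flow:
  assumes "(f \<longlongrightarrow> a) net" "(g \<longlongrightarrow> b) net"
  shows "((\<lambda>x. F (f x) (g x)) \<longlongrightarrow> F a b) net"
proof -
  have "isCont (\<lambda>p. F (snd p) (fst p)) (b, a)"
    using cont continuous_on_eq_continuous_at open_UNIV by blast
  from isCont_tendsto_compose[OF this tendsto_Pair[OF assms(2,1)]] show ?thesis
    by simp
qed

lemma flow_eq_iff: "F t z = F t w \<longleftrightarrow> z = w"
  by (metis flow_add flow_0 add.right_inverse)

lemma flow_eq_imp_period:
  assumes "F s z = F t z"
  shows "F (t - s) z = z"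
  by (metis assms diff_add_cancel flow_add flow_eq_iff)

lemma flow_int_period:
  assumes "F r z = z"
  shows "F (of_int k * r) z = z"
proof -
  have nat: "F (of_nat n * r) z = z" for n
    by (induction n) (simp_all add: distrib_right flow_add[symmetric] assms add.commute)
  show ?thesis
  proof (cases "0 \<le> k")
    case True
    then show ?thesis using nat[of "nat k"] by simp
  next
    case False
    then have "F (- (of_int k * r)) z = z" using nat[of "nat (-k)"] by simp
    then show ?thesis by (metis flow_add flow_0 add.left_inverse)
  qed
qed

text \<open>
Periodic orbits of period tending to zero could be moved along themselves into \<open>B\<close>, and would accumulate
at a fixed point there.
\<close>
lemma no_short_periods:
  obtains s where "0 < s" "\<And>z r. \<lbrakk>z \<in> U; 0 < r; r \<le> s\<rbrakk> \<Longrightarrow> F r z \<noteq> z"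
proof (rule ccontr)
  assume neg: "\<not> thesis"
  note small = that
  have "\<exists>z r. z \<in> B \<and> 0 < r \<and> r \<le> inverse (real (Suc n)) \<and> F r z = z" for n
  proof -
    obtain z r where zr: "z \<in> U" "0 < r" "r \<le> inverse (real (Suc n))" "F r z = z"
      using neg small[of "inverse (real (Suc n))"] by (metis inverse_positive_iff_positive of_nat_0_less_iff zero_less_Suc)
    obtain t where "F t z \<in> B"
      using meets_B zr(1) by blast
    moreover have "F r (F t z) = F t z"
      by (metis flow_add add.commute zr(4))
    ultimately show ?thesis
      using zr by blast
  qed
  then obtain z r where z: "\<And>n. z n \<in> B" and r: "\<And>n. 0 < r n" "\<And>n. r n \<le> inverse (real (Suc n))"
    and period: "\<And>n. F (r n) (z n) = z n"
    by metis
  obtain l \<sigma> where l: "l \<in> B" "strict_mono \<sigma>" "(z \<circ> \<sigma>) \<longlonglongrightarrow> l"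
    using B(1) z unfolding compact_def by blast
  have r0: "r \<longlonglongrightarrow> 0"
    by (rule tendsto_sandwich[OF _ _ tendsto_const LIMSEQ_inverse_real_of_nat])
      (use r in \<open>auto intro!: eventuallyI less_imp_le simp del: of_nat_Suc\<close>)
  have "F t l = l" for t
  proof -
    (* t reduced modulo the period r n *)
    define \<rho> where "\<rho> n = t - of_int \<lfloor>t / r n\<rfloor> * r n" for n
    have \<rho>: "0 \<le> \<rho> n" "\<rho> n \<le> r n" for n
      using r(1)[of n] floor_divide_lower[OF r(1), of t n] floor_divide_upper[OF r(1), of t n]
      by (auto simp: \<rho>_def algebra_simps)
    have "\<rho> \<longlonglongrightarrow> 0"
      by (rule tendsto_sandwich[OF _ _ tendsto_const r0]) (use \<rho> in auto)
    then have "(\<lambda>n. F (\<rho> (\<sigma> n)) (z (\<sigma> n))) \<longlonglongrightarrow> F 0 l"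
      using l by (intro tendsto_flow) (auto simp: o_def dest: LIMSEQ_subseq_LIMSEQ)
    moreover have "F (\<rho> n) (z n) = F t (z n)" for n
      using flow_int_period[OF period, of "\<lfloor>t / r n\<rfloor>" n]
        flow_add[of "\<rho> n" "of_int \<lfloor>t / r n\<rfloor> * r n" "z n"]
      by (simp add: \<rho>_def)
    moreover have "(\<lambda>n. F t (z (\<sigma> n))) \<longlonglongrightarrow> F t l"
      using l by (intro tendsto_flow tendsto_const) (auto simp: o_def)
    ultimately show ?thesis
      using LIMSEQ_unique by auto
  qed
  then show False
    using no_fixed_point l B by blast
qed

lemma simply_connected_U: "simply_connected U"
proof -
  have "\<not> bounded (- U)"
    using U(3) cobounded_imp_unbounded by auto
  moreover from this have "components (- U) = {- U}"
    using U(5) by (metis bounded_empty components_eq_sing_iff)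
  ultimately show ?thesis
    using U by (simp add: simply_connected_eq_unbounded_complement_components)
qed

text \<open>
All contradictions with winding numbers come from here: on a simply connected set a field without zeros does
not wind along any loop.
\<close>
lemma displacement_log:
  assumes "\<And>z. z \<in> U \<Longrightarrow> F s z \<noteq> z"
  obtains G where "continuous_on U G" "\<And>z. z \<in> U \<Longrightarrow> exp (G z) = F s z - z"
proof -
  have "continuous_on U (\<lambda>z. F s z - z) \<and> (\<forall>z\<in>U. F s z - z \<noteq> 0)"
    using assms by (auto intro!: continuous_on_diff continuous_on_flow continuous_on_const continuous_on_id)
  then have "\<exists>g. continuous_on U g \<and> (\<forall>z\<in>U. F s z - z = exp (g z))"
    using simply_connected_U unfolding simply_connected_eq_continuous_log[OF U(1)] by blast
  then show ?thesis
    using that by metis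
qed

text \<open>
A periodic orbit, run through once, is a simple loop along which the displacement by a short time \<open>s\<close> is
exactly a secant; the loop has no short part, so both \<open>T\<close> and \<open>L\<close> are the minimal period.
\<close>
lemma no_periodic_point:
  assumes z: "z \<in> U" and "t \<noteq> 0"
  shows "F t z \<noteq> z"
proof
  assume per: "F t z = z"
  obtain s where s: "0 < s" "\<And>z r. \<lbrakk>z \<in> U; 0 < r; r \<le> s\<rbrakk> \<Longrightarrow> F r z \<noteq> z"
    using no_short_periods by blast
  define X where "X = {r. s \<le> r \<and> F r z = z}"
  have "F \<bar>t\<bar> z = z"
    using per flow_int_period[OF per, of "-1"] by (auto simp: abs_if)
  then have "\<bar>t\<bar> \<in> X"
    using s(2)[OF z, of "\<bar>t\<bar>"] \<open>t \<noteq> 0\<close> unfolding X_def by force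
  moreover have "closed X"
  proof -
    have "X = {s..} \<inter> {r. F r z = z}"
      by (auto simp: X_def)
    moreover have "closed {r. F r z = z}"
      by (intro closed_Collect_eq continuous_intros)
    ultimately show ?thesis by auto
  qed
  moreover have bdd: "bdd_below X"
    by (auto simp: X_def intro!: bdd_belowI)
  ultimately have "Inf X \<in> X"
    using closed_contains_Inf by blast
  define T where "T = Inf X"
  have T: "F T z = z" "s < T"
    using \<open>Inf X \<in> X\<close> s z by (auto simp: X_def T_def less_le)
  have min: "F r z \<noteq> z" if "0 < r" "r < T" for r
  proof (cases "r \<le> s")
    case False
    then show ?thesis
      using that cInf_lower[OF _ bdd, of r] by (force simp: X_def T_def)
  qed (use s z that in auto)
  obtain G where G: "continuous_on U G" "\<And>z. z \<in> U \<Longrightarrow> exp (G z) = F s z - z"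
    using displacement_log[of s] s(2)[of _ s] s(1) by (metis order_refl)
  show False
  proof (rule no_log_of_field_along_loop[of s T T "\<lambda>u. F u z" "\<lambda>u. G (F u z)" "\<lambda>u. F s (F u z) - F u z"])
    show "continuous_on {0..T} (\<lambda>u. G (F u z))"
      by (intro continuous_on_compose2[OF G(1)] continuous_intros) (use z invariant in auto)
    show "u = 0 \<and> v = T" if "0 \<le> u" "u < v" "v \<le> T" "F u z = F v z" for u v
    proof -
      have "F (v - u) z = z"
        using that(4) by (rule flow_eq_imp_period)
      then show ?thesis using min[of "v - u"] that by force
    qed
    have nz: "F s (F u z) \<noteq> F u z" for u
      using s z invariant by auto
    show "cmod (F (u + s) z - F u z - (F s (F u z) - F u z)) < cmod (F s (F u z) - F u z)" for u
      using nz by (simp add: flow_add)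
    show "cmod (F v z - F (T - s) z - (F s (F (T - s) z) - F (T - s) z)) < cmod (F s (F (T - s) z) - F (T - s) z)"
      if "T \<le> v" "v \<le> T" for v
      using nz[of "T - s"] that by (simp add: flow_add)
    show "cmod (F s z - F u z - (F s (F u z) - F u z)) < cmod (F s (F u z) - F u z)"
      if "T \<le> u" "u \<le> T" for u
      using nz[of u] that T by simp
    show "cmod (F (u + s - T) z - F u z - (F s (F u z) - F u z)) < cmod (F s (F u z) - F u z)" for u
    proof -
      have "F (u + s - T) z = F (u + s - T) (F T z)"
        using T by simp
      then show ?thesis using nz[of u] by (simp only: flow_add) simp
    qed
    show "continuous_on {0..T} (\<lambda>u. F u z)"
      by (intro continuous_intros)
    show "exp (G (F u z)) = F s (F u z) - F u z" for u
      using G z invariant by blast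
  qed (use s(1) T in simp_all)
qed

lemma flow_inj: "z \<in> U \<Longrightarrow> F s z = F t z \<longleftrightarrow> s = t"
  by (metis flow_eq_imp_period no_periodic_point right_minus_eq)

subsection \<open>Absence of recurrence\<close>

lemma flow_tube:
  assumes "0 < m"
  obtains \<delta> where "0 < \<delta>" "\<And>z r. \<lbrakk>z \<in> ball y \<delta>; a \<le> r; r \<le> b\<rbrakk> \<Longrightarrow> dist (F r z) (F r y) < m"
proof -
  have "uniformly_continuous_on ({a..b} \<times> cball y 1) (\<lambda>p. F (fst p) (snd p))"
    by (intro compact_uniformly_continuous continuous_intros compact_Times) auto
  then obtain \<delta> where \<delta>: "0 < \<delta>"
    "\<And>p q. \<lbrakk>p \<in> {a..b} \<times> cball y 1; q \<in> {a..b} \<times> cball y 1; dist p q < \<delta>\<rbrakk>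
      \<Longrightarrow> dist (F (fst p) (snd p)) (F (fst q) (snd q)) < m"
    using assms unfolding uniformly_continuous_on_def by (metis dist_commute)
  show ?thesis
  proof (rule that[of "min \<delta> 1"])
    show "dist (F r z) (F r y) < m" if "z \<in> ball y (min \<delta> 1)" "a \<le> r" "r \<le> b" for z r
      using \<delta>(2)[of "(r, z)" "(r, y)"] that by (auto simp: dist_Pair_Pair dist_commute)
  qed (use \<delta> in auto)
qed

lemma displacement_bounded_below:
  fixes f g :: "real \<Rightarrow> real"
  assumes y: "y \<in> U" and ab: "a \<le> b" "\<And>r. r \<in> {a..b} \<Longrightarrow> f r \<noteq> g r"
    and fg: "continuous_on {a..b} f" "continuous_on {a..b} g"
  obtains m where "0 < m" "\<And>r. r \<in> {a..b} \<Longrightarrow> m \<le> dist (F (f r) y) (F (g r) y)"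
proof -
  have "continuous_on {a..b} (\<lambda>r. dist (F (f r) y) (F (g r) y))"
    using fg by (intro continuous_intros)
  then have "\<exists>r0\<in>{a..b}. \<forall>r\<in>{a..b}. dist (F (f r0) y) (F (g r0) y) \<le> dist (F (f r) y) (F (g r) y)"
    using ab(1) by (intro continuous_attains_inf) auto
  then obtain r0 where r0: "r0 \<in> {a..b}"
    "\<And>r. r \<in> {a..b} \<Longrightarrow> dist (F (f r0) y) (F (g r0) y) \<le> dist (F (f r) y) (F (g r) y)"
    by blast
  show ?thesis
    by (rule that[OF _ r0(2)]) (use r0(1) ab y in \<open>auto simp: flow_inj\<close>)
qed

text \<open>
A late return to a small ball gives a piece of orbit whose end points are joined by a short segment.
Choosing the two end points on the original segment as close to each other as possible, among all
pairs that are at least one time unit apart, makes the orbit piece meet the segment between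
them in the end points only: any further intersection would be at least one time unit away from one of the
end points and closer to it than they are to each other. So a simple loop arises, made of an orbit piece followed by a segment that
is short compared with the displacement by time 1, and the displacement cannot have a logarithm along it.
\<close>
lemma no_return:
  assumes y: "y \<in> U"
  obtains \<epsilon> where "0 < \<epsilon>" "\<And>z t. \<lbrakk>z \<in> ball y \<epsilon>; 1 \<le> t\<rbrakk> \<Longrightarrow> F t z \<notin> ball y \<epsilon>"
proof -
  obtain m1 where m1: "0 < m1" "\<And>r. r \<in> {1..2} \<Longrightarrow> m1 \<le> dist (F r y) (F 0 y)"
    by (rule displacement_bounded_below[OF y, of 1 2 "\<lambda>r. r" "\<lambda>r. 0"]) auto
  obtain m2 where m2: "0 < m2" "\<And>r. r \<in> {-1..0} \<Longrightarrow> m2 \<le> dist (F (r + 1) y) (F r y)"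
    by (rule displacement_bounded_below[OF y, of "-1" 0 "\<lambda>r. r + 1" "\<lambda>r. r"])
      (auto intro!: continuous_intros)
  (* The displacement by time 1 stays above 3 m near y and flow lines of points near y stay within
     2 m of each other: each of the two points involved costs m against the bound 5 m at y. *)
  define m where "m = min m1 m2 / 5"
  have m: "0 < m" "\<And>r. r \<in> {1..2} \<Longrightarrow> 5 * m \<le> dist (F r y) y"
    "\<And>r. r \<in> {-1..0} \<Longrightarrow> 5 * m \<le> dist (F (r + 1) y) (F r y)"
    using m1 m2 by (fastforce simp: m_def)+
  obtain \<delta> where \<delta>: "0 < \<delta>"
    "\<And>z r. \<lbrakk>z \<in> ball y \<delta>; -1 \<le> r; r \<le> 2\<rbrakk> \<Longrightarrow> dist (F r z) (F r y) < m"
    using flow_tube[OF m(1), of y "-1" 2] by metis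
  obtain e where e: "0 < e" "ball y e \<subseteq> U"
    using y U(1) open_contains_ball by blast
  define \<epsilon> where "\<epsilon> = min (min \<delta> e) m"
  have \<epsilon>: "0 < \<epsilon>" "ball y \<epsilon> \<subseteq> U" "\<epsilon> \<le> m"
    using \<delta> e m by (auto simp: \<epsilon>_def)
  have tube: "dist (F r z) (F r y) < m" if "z \<in> ball y \<epsilon>" "-1 \<le> r" "r \<le> 2" for z r
    using \<delta>(2)[of z r] that by (auto simp: \<epsilon>_def)
  have near: "dist (F r z) (F r w) < 2 * m" if "z \<in> ball y \<epsilon>" "w \<in> ball y \<epsilon>" "-1 \<le> r" "r \<le> 2" for z w r
    using tube[of z r] tube[of w r] that dist_triangle2[of "F r z" "F r w" "F r y"] by linarith
  have far: "3 * m < dist (F (r + 1) z) (F r z)" if "z \<in> ball y \<epsilon>" "-1 \<le> r" "r \<le> 0" for z r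
    using tube[of z r] tube[of z "r + 1"] that m(3)[of r] 
      dist_triangle[of "F (r + 1) y" "F r y" "F (r + 1) z"]
      dist_triangle[of "F (r + 1) z" "F r y" "F r z"] dist_commute[of "F (r + 1) z" "F (r + 1) y"]
    by auto
  have leaves: "F r z \<notin> ball y \<epsilon>" if "z \<in> ball y \<epsilon>" "1 \<le> r" "r \<le> 2" for z r
    using tube[of z r] that m(1) m(2)[of r] \<epsilon> dist_triangle[of "F r y" y "F r z"]
    by (auto simp: dist_commute)
  show ?thesis
  proof (rule that[OF \<epsilon>(1)])
    fix z and t :: real assume z: "z \<in> ball y \<epsilon>" and t: "1 \<le> t"
    show "F t z \<notin> ball y \<epsilon>"
    proof
      assume ret: "F t z \<in> ball y \<epsilon>"
      define J where "J = closed_segment z (F t z)"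
      have J: "J \<subseteq> ball y \<epsilon>" "closed J" "convex J"
        using closed_segment_subset[OF z ret convex_ball] by (simp_all add: J_def)
      have zU: "z \<in> U"
        using z \<epsilon> by blast
      define Q where "Q = {p \<in> {0..t} \<times> {0..t}. fst p + 1 \<le> snd p \<and> F (fst p) z \<in> J \<and> F (snd p) z \<in> J}"
      have "compact Q"
      proof -
        have "closed {p :: real \<times> real. fst p + 1 \<le> snd p}"
          by (intro closed_Collect_le continuous_intros)
        moreover have "closed ((\<lambda>p :: real \<times> real. F (fst p) z) -` J)" "closed ((\<lambda>p :: real \<times> real. F (snd p) z) -` J)"
          by (intro closed_vimage J continuous_intros)+
        ultimately have "closed ({p. fst p + 1 \<le> snd p} \<inter> (\<lambda>p. F (fst p) z) -` J \<inter> (\<lambda>p. F (snd p) z) -` J)"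
          by auto
        then have "compact (({0..t} \<times> {0..t}) \<inter> ({p. fst p + 1 \<le> snd p} \<inter> (\<lambda>p. F (fst p) z) -` J \<inter> (\<lambda>p. F (snd p) z) -` J))"
          by (intro compact_Int_closed compact_Times) auto
        then show ?thesis
          by (rule back_subst[of compact]) (auto simp: Q_def)
      qed
      moreover have "(0, t) \<in> Q"
        using t by (auto simp: Q_def J_def)
      moreover have "continuous_on Q (\<lambda>p. dist (F (fst p) z) (F (snd p) z))"
        by (intro continuous_intros)
      ultimately have "\<exists>p\<in>Q. \<forall>q\<in>Q. dist (F (fst p) z) (F (snd p) z) \<le> dist (F (fst q) z) (F (snd q) z)"
        by (intro continuous_attains_inf) auto
      then obtain p where p: "p \<in> Q"
        "\<forall>q\<in>Q. dist (F (fst p) z) (F (snd p) z) \<le> dist (F (fst q) z) (F (snd q) z)"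
        by blast
      obtain a b where ab_eq: "p = (a, b)"
        by (rule prod.exhaust)
      have ab: "(a, b) \<in> Q"
        using p(1) by (simp add: ab_eq)
      have min: "dist (F a z) (F b z) \<le> dist (F a' z) (F b' z)" if "(a', b') \<in> Q" for a' b'
        using p(2)[rule_format, OF that] by (simp add: ab_eq)
      define x0 where "x0 = F a z"
      define y1 where "y1 = F b z"
      define T where "T = b - a"
      have xy: "x0 \<in> J" "y1 \<in> J" "0 \<le> a" "b \<le> t" "1 \<le> T"
        using ab by (auto simp: Q_def x0_def y1_def T_def)
      have FT: "F T x0 = y1" and Fx0: "F u x0 = F (a + u) z" for u
        by (auto simp: x0_def y1_def T_def flow_add)
      (* Hence a point strictly between the two end points in time is at least one unit away from
         one of them. *)
      have "2 < T"
        using leaves[of x0 T] xy J FT by force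
      have x0U: "x0 \<in> U"
        using xy J \<epsilon> by blast
      have "x0 \<noteq> y1"
        using flow_inj[OF zU, of a b] \<open>2 < T\<close> by (auto simp: x0_def y1_def T_def)
      define \<gamma> where "\<gamma> u = (if u \<le> T then F u x0 else y1 + (u - T) *\<^sub>R (x0 - y1))" for u
      have seg: "\<gamma> u \<in> closed_segment x0 y1" if "T \<le> u" "u \<le> T + 1" for u
      proof -
        have "\<gamma> u = (1 - (T + 1 - u)) *\<^sub>R x0 + (T + 1 - u) *\<^sub>R y1"
          using that FT by (auto simp: \<gamma>_def algebra_simps)
        then show ?thesis
          using that by (auto simp: closed_segment_def intro!: exI[of _ "T + 1 - u"])
      qed
      have segJ: "closed_segment x0 y1 \<subseteq> J"
        using xy J by (simp add: closed_segment_subset)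
      have ball: "\<gamma> u \<in> ball y \<epsilon>" if "T \<le> u" "u \<le> T + 1" for u
        using seg[OF that] segJ J by blast
      have \<gamma>U: "\<gamma> u \<in> U" if "u \<le> T + 1" for u
        using ball[of u] that \<epsilon> x0U invariant by (cases "u \<le> T") (auto simp: \<gamma>_def)
      have x0_ball: "x0 \<in> ball y \<epsilon>" "y1 \<in> ball y \<epsilon>"
        using xy J by auto
      obtain G where G: "continuous_on U G" "\<And>z. z \<in> U \<Longrightarrow> exp (G z) = F 1 z - z"
        using displacement_log[of 1] no_periodic_point[of _ 1] by (metis zero_neq_one)
      have cont\<gamma>: "continuous_on {0..T + 1} \<gamma>"
        unfolding \<gamma>_def
        by (rule continuous_on_cases_le) (auto intro!: continuous_intros simp: FT)
      show False
      proof (rule no_log_of_field_along_loop[of 1 T "T + 1" \<gamma> "\<lambda>u. G (\<gamma> u)" "\<lambda>u. F 1 (\<gamma> u) - \<gamma> u"])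
        show "continuous_on {0..T + 1} (\<lambda>u. G (\<gamma> u))"
          by (intro continuous_on_compose2[OF G(1) cont\<gamma>]) (use \<gamma>U in auto)
        show "\<gamma> (T + 1) = \<gamma> 0"
          using \<open>2 < T\<close> by (simp add: \<gamma>_def)
        then show "G (\<gamma> (T + 1)) = G (\<gamma> 0)"
          by simp
        show "u = 0 \<and> v = T + 1" if uv: "0 \<le> u" "u < v" "v \<le> T + 1" "\<gamma> u = \<gamma> v" for u v
        proof -
          consider "v \<le> T" | "T \<le> u" "T < v" | "u < T" "T < v"
            using uv by linarith
          then show ?thesis
          proof cases
            case 1
            then show ?thesis
              using uv flow_inj[OF x0U, of u v] by (auto simp: \<gamma>_def)
          next
            case 2
            have "\<gamma> u = y1 + (u - T) *\<^sub>R (x0 - y1)"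
              using 2 FT by (auto simp: \<gamma>_def)
            then have "(u - T) *\<^sub>R (x0 - y1) = (v - T) *\<^sub>R (x0 - y1)"
              using 2 uv by (simp add: \<gamma>_def)
            then show ?thesis
              using \<open>x0 \<noteq> y1\<close> uv by simp
          next
            case 3
            define w where "w = F (a + u) z"
            have w: "w = \<gamma> u" "w = \<gamma> v"
              using 3 uv by (auto simp: w_def \<gamma>_def Fx0)
            have "w \<in> closed_segment x0 y1"
              using seg[of v] 3 uv w by auto
            then have wJ: "w \<in> J" and dw: "dist x0 y1 = dist x0 w + dist w y1"
              using segJ by (auto simp: between_mem_segment[symmetric] between)
            have "w \<noteq> y1"
              using flow_inj[OF zU, of "a + u" b] 3 by (auto simp: w_def y1_def T_def)
            show ?thesis
            proof (cases "u = 0")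
              case True
              have "y1 + (v - T) *\<^sub>R (x0 - y1) = x0"
                using w True 3 by (auto simp: \<gamma>_def w_def x0_def)
              then have "(v - T) *\<^sub>R (x0 - y1) = 1 *\<^sub>R (x0 - y1)"
                by (simp add: algebra_simps)
              then have "v - T = 1"
                using \<open>x0 \<noteq> y1\<close> by (simp only: scaleR_cancel_right) auto
              then show ?thesis
                using True by simp
            next
              case False
              have "w \<noteq> x0"
                using flow_inj[OF zU, of "a + u" a] False by (auto simp: w_def x0_def)
              show ?thesis
              proof (cases "1 \<le> u")
                case True
                have "(a, a + u) \<in> Q"
                  using True 3 xy wJ by (auto simp: Q_def w_def x0_def T_def)
                then show ?thesis
                  using min[of a "a + u"] dw \<open>w \<noteq> y1\<close> by (simp add: x0_def y1_def w_def)
              next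
                case False
                have "(a + u, b) \<in> Q"
                  using False 3 uv xy wJ \<open>2 < T\<close> by (auto simp: Q_def w_def y1_def T_def)
                then show ?thesis
                  using min[of "a + u" b] dw \<open>w \<noteq> x0\<close> by (simp add: x0_def y1_def w_def)
              qed
            qed
          qed
        qed
        show "exp (G (\<gamma> u)) = F 1 (\<gamma> u) - \<gamma> u" if "0 \<le> u" "u \<le> T + 1" for u
          using G \<gamma>U that by blast
        show "cmod (\<gamma> (u + 1) - \<gamma> u - (F 1 (\<gamma> u) - \<gamma> u)) < cmod (F 1 (\<gamma> u) - \<gamma> u)"
          if "0 \<le> u" "u \<le> T - 1" for u
          using no_periodic_point[OF \<gamma>U[of u], of 1] that by (auto simp: \<gamma>_def flow_add)
        show "cmod (\<gamma> v - \<gamma> (T - 1) - (F 1 (\<gamma> (T - 1)) - \<gamma> (T - 1)))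
            < cmod (F 1 (\<gamma> (T - 1)) - \<gamma> (T - 1))" if "T \<le> v" "v \<le> T + 1" for v
        proof -
          have "\<gamma> (T - 1) = F (-1) y1"
            by (simp add: \<gamma>_def flow_add flip: FT)
          then show ?thesis
            using near[OF ball[OF that] x0_ball(2), of 0] far[OF x0_ball(2), of "-1"] m(1)
            by (simp add: flow_add dist_norm)
        qed
        show "cmod (\<gamma> (u + 1 - T) - \<gamma> u - (F 1 (\<gamma> u) - \<gamma> u)) < cmod (F 1 (\<gamma> u) - \<gamma> u)"
          if "T - 1 \<le> u" "u \<le> T" for u
        proof -
          have "\<gamma> u = F (u - T) y1" "\<gamma> (u + 1 - T) = F (u + 1 - T) x0"
            using that \<open>2 < T\<close> by (simp_all add: \<gamma>_def flow_add flip: FT)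
          then show ?thesis
            using near[OF x0_ball, of "u + 1 - T"] far[OF x0_ball(2), of "u - T"] m(1) that
            by (simp add: flow_add dist_norm algebra_simps)
        qed
        show "cmod (\<gamma> 1 - \<gamma> u - (F 1 (\<gamma> u) - \<gamma> u)) < cmod (F 1 (\<gamma> u) - \<gamma> u)"
          if "T \<le> u" "u \<le> T + 1" for u
        proof -
          have "\<gamma> 1 = F 1 x0"
            using \<open>2 < T\<close> by (simp add: \<gamma>_def)
          then show ?thesis
            using near[OF x0_ball(1) ball[OF that], of 1] far[OF ball[OF that], of 0] m(1)
            by (simp add: dist_norm)
        qed
      qed (use \<open>2 < T\<close> cont\<gamma> in auto)
    qed
  qed
qed

subsection \<open>Orbits separate the disc\<close>

definition orbit :: "complex \<Rightarrow> complex set" where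
  "orbit x = range (\<lambda>t. F t x)"

lemma return_time_bound:
  assumes "w \<in> U"
  obtains \<epsilon> where "0 < \<epsilon>"
    "\<And>x s t. \<lbrakk>F s x \<in> ball w \<epsilon>; F t x \<in> ball w \<epsilon>\<rbrakk> \<Longrightarrow> \<bar>t - s\<bar> < 1"
proof -
  obtain \<epsilon> where \<epsilon>: "0 < \<epsilon>" "\<And>z t. \<lbrakk>z \<in> ball w \<epsilon>; 1 \<le> t\<rbrakk> \<Longrightarrow> F t z \<notin> ball w \<epsilon>"
    using no_return[OF assms] by blast
  have *: "t - s < 1" if "F s x \<in> ball w \<epsilon>" "F t x \<in> ball w \<epsilon>" for x s t
  proof (rule ccontr)
    assume "\<not> t - s < 1"
    then show False
      using \<epsilon>(2)[OF that(1), of "t - s"] that(2) by (simp add: flow_add)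
  qed
  show ?thesis
  proof (rule that[OF \<epsilon>(1)])
    show "\<bar>t - s\<bar> < 1" if "F s x \<in> ball w \<epsilon>" "F t x \<in> ball w \<epsilon>" for x s t
      using *[OF that] *[OF that(2,1)] by linarith
  qed
qed

text \<open>
Near a point of \<open>U\<close> an orbit is seen only during a bounded span of time, and a compact piece of it is closed.
\<close>
lemma closed_orbit_part:
  assumes "closed I"
  shows "closed ((\<lambda>t. F t x) ` I \<union> - U)"
proof -
  let ?A = "(\<lambda>t. F t x) ` I"
  have "w \<in> ?A" if w: "w \<in> closure ?A" "w \<in> U" for w
  proof -
    obtain \<epsilon> where \<epsilon>: "0 < \<epsilon>"
      "\<And>x s t. \<lbrakk>F s x \<in> ball w \<epsilon>; F t x \<in> ball w \<epsilon>\<rbrakk> \<Longrightarrow> \<bar>t - s\<bar> < 1"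
      using return_time_bound[OF w(2)] by blast
    have "ball w \<epsilon> \<inter> closure ?A \<subseteq> closure (ball w \<epsilon> \<inter> ?A)"
      by (rule open_Int_closure_subset) auto
    then have wc: "w \<in> closure (ball w \<epsilon> \<inter> ?A)"
      using w \<epsilon>(1) by auto
    then have "ball w \<epsilon> \<inter> ?A \<noteq> {}"
      by auto
    then obtain s where s: "F s x \<in> ball w \<epsilon>"
      by blast
    let ?C = "(\<lambda>t. F t x) ` ({s - 1..s + 1} \<inter> I)"
    have "ball w \<epsilon> \<inter> ?A \<subseteq> ?C"
    proof
      fix v assume "v \<in> ball w \<epsilon> \<inter> ?A"
      then obtain t where t: "t \<in> I" "v = F t x" "F t x \<in> ball w \<epsilon>"
        by auto
      then show "v \<in> ?C"
        using \<epsilon>(2)[OF s t(3)] by (auto intro!: imageI)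
    qed
    moreover have "compact ?C"
      using assms by (intro compact_continuous_image continuous_intros compact_Int_closed) auto
    ultimately have "w \<in> ?C"
      using wc closure_minimal compact_imp_closed by blast
    then show ?thesis by blast
  qed
  then have "closure (?A \<union> - U) \<subseteq> ?A \<union> - U"
    using U(1) by (auto simp: closure_Un closure_closed closed_Compl simp del: closure_complement)
  then show ?thesis
    using closure_subset_eq by blast
qed

text \<open>
A piece of orbit of unbounded duration cannot accumulate in \<open>U\<close>, so it accumulates at the complement of
\<open>U\<close>, which is connected.
\<close>
lemma connected_orbit_part:
  assumes x: "x \<in> U" and I: "connected I" "\<And>n::nat. \<exists>t\<in>I. real n \<le> \<bar>t\<bar>"
  shows "connected ((\<lambda>t. F t x) ` I \<union> - U)"
proof -
  let ?A = "(\<lambda>t. F t x) ` I"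
  obtain \<tau> where \<tau>: "\<And>n. \<tau> n \<in> I" "\<And>n. real n \<le> \<bar>\<tau> n\<bar>"
    using I(2) by metis
  have "compact (closure U)"
    using U(3) by simp
  moreover have "F (\<tau> n) x \<in> closure U" for n
    using invariant[OF x] closure_subset by blast
  ultimately obtain l \<sigma> where l: "strict_mono \<sigma>" "((\<lambda>n. F (\<tau> n) x) \<circ> \<sigma>) \<longlonglongrightarrow> l"
    unfolding compact_def by metis
  have "l \<notin> U"
  proof
    assume "l \<in> U"
    then obtain \<epsilon> where \<epsilon>: "0 < \<epsilon>"
      "\<And>x s t. \<lbrakk>F s x \<in> ball l \<epsilon>; F t x \<in> ball l \<epsilon>\<rbrakk> \<Longrightarrow> \<bar>t - s\<bar> < 1"
      using return_time_bound by blast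
    obtain N where N: "\<And>n. N \<le> n \<Longrightarrow> F (\<tau> (\<sigma> n)) x \<in> ball l \<epsilon>"
      using l(2) \<epsilon>(1) unfolding lim_sequentially by (auto simp: dist_commute)
    obtain k :: nat where k: "\<bar>\<tau> (\<sigma> N)\<bar> + 1 < real k"
      using reals_Archimedean2 by blast
    have "real k \<le> \<bar>\<tau> (\<sigma> (max N k))\<bar>"
      using \<tau>(2)[of "\<sigma> (max N k)"] seq_suble[OF l(1), of "max N k"] by linarith
    moreover have "\<bar>\<tau> (\<sigma> (max N k)) - \<tau> (\<sigma> N)\<bar> < 1"
      by (rule \<epsilon>(2)) (rule N; simp)+
    ultimately show False
      using k by linarith
  qed
  have "l \<in> closure ?A"
    using l(2) \<tau>(1) unfolding closure_sequential by (intro exI[of _ "(\<lambda>n. F (\<tau> n) x) \<circ> \<sigma>"]) auto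
  moreover have "connected ?A"
    using I(1) by (intro connected_continuous_image continuous_intros) auto
  ultimately have "connected (insert l ?A)"
    using closure_subset[of ?A] by (intro connected_intermediate_closure[of ?A "insert l ?A"]) (simp_all add: subset_insertI)
  then have "connected (insert l ?A \<union> - U)"
    using U(5) \<open>l \<notin> U\<close> by (intro connected_Un) auto
  moreover have "insert l ?A \<union> - U = ?A \<union> - U"
    using \<open>l \<notin> U\<close> by blast
  ultimately show ?thesis
    by simp
qed

text \<open>
The forward and the backward half of the orbit, completed by the complement of \<open>U\<close>, meet in the
complement of \<open>U\<close> and in the isolated point \<open>x\<close>, so Janiszewski's theorem applies, provided that the orbit does
not fill \<open>U\<close>. It does not: removing \<open>x\<close> would disconnect it, while \<open>U\<close> without a point is connected.
\<close>
lemma orbit_separates: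
  assumes x: "x \<in> U"
  shows "\<not> connected (U - orbit x)"
proof
  assume conn: "connected (U - orbit x)"
  let ?P = "(\<lambda>t. F t x) ` {0..} \<union> - U" and ?N = "(\<lambda>t. F t x) ` {..0} \<union> - U"
  have orbit_eq: "orbit x = (\<lambda>t. F t x) ` {0..} \<union> (\<lambda>t. F t x) ` {..0}"
    unfolding orbit_def image_Un[symmetric] by (rule arg_cong[where f = "image _"]) auto
  have Un: "?P \<union> ?N = - (U - orbit x)"
    unfolding orbit_eq by blast
  have "(\<lambda>t. F t x) ` {0..} \<inter> (\<lambda>t. F t x) ` {..0} = {x}"
    using flow_inj[OF x] by (force simp: image_iff)
  then have Int: "?P \<inter> ?N = {x} \<union> - U"
    using invariant[OF x] by blast
  have closed: "closed ?P" "closed ?N"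
    by (intro closed_orbit_part; simp)+
  have unbounded: "\<not> bounded (- U)"
    using U(3) cobounded_imp_unbounded by auto
  have "?P \<union> ?N \<noteq> UNIV"
  proof
    assume all: "?P \<union> ?N = UNIV"
    have "connected (U - {x})"
      using U by (intro connected_open_delete) auto
    moreover have "U - {x} \<subseteq> ?P \<union> ?N" "?P \<inter> ?N \<inter> (U - {x}) = {}"
      using all Int by blast+
    moreover have "F 1 x \<in> ?P \<inter> (U - {x})" "F (-1) x \<in> ?N \<inter> (U - {x})"
      using no_periodic_point[OF x] invariant[OF x] by auto
    ultimately show False
      using closed unfolding connected_closed by blast
  qed
  moreover have "connected ?P"
    by (intro connected_orbit_part x) (auto intro!: bexI[of _ "real _"])
  moreover have "connected ?N"
    by (intro connected_orbit_part x) (auto intro!: bexI[of _ "- real _"])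
  moreover have "connected (- (?P \<union> ?N))"
    unfolding Un double_compl by (rule conn)
  moreover have "\<not> bounded ?P" "\<not> bounded ?N"
    using unbounded by (auto simp: bounded_Un)
  ultimately have "{x} = {}"
    using closed Int U x by (intro Janiszewski_dual_unbounded[of ?P ?N "{x}" "- U"]) auto
  then show False by simp
qed

subsection \<open>Minimal sides\<close>

lemma orbit_refl: "x \<in> orbit x"
  unfolding orbit_def by (rule range_eqI[of _ _ 0]) simp

lemma orbit_subset: "x \<in> U \<Longrightarrow> orbit x \<subseteq> U"
  using invariant by (auto simp: orbit_def)

lemma orbit_eq:
  assumes "y \<in> orbit x"
  shows "orbit y = orbit x"
proof -
  obtain s where s: "y = F s x"
    using assms by (auto simp: orbit_def)
  have 1: "F t x = F (t - s) y" and 2: "F t y = F (s + t) x" for t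
    by (simp_all add: s flow_add)
  show ?thesis
    unfolding orbit_def
  proof (intro subset_antisym image_subsetI)
    show "F t x \<in> range (\<lambda>t. F t y)" for t
      unfolding 1 by (rule rangeI)
    show "F t y \<in> range (\<lambda>t. F t x)" for t
      unfolding 2 by (rule rangeI)
  qed
qed

lemma connected_orbit: "connected (orbit x)"
  unfolding orbit_def by (intro connected_continuous_image continuous_intros) auto

definition sides :: "complex \<Rightarrow> complex set set" where
  "sides x = components (U - orbit x)"

lemma side_subset: "S \<in> sides x \<Longrightarrow> S \<subseteq> U - orbit x"
  by (simp add: sides_def in_components_subset)

lemma orbit_subset_side:
  assumes "S \<in> sides x" "y \<in> S"
  shows "orbit y \<subseteq> S"
proof -
  have y: "y \<in> U" "y \<notin> orbit x"
    using side_subset assms by blast+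
  then have "orbit y \<inter> orbit x = {}"
    using orbit_eq orbit_refl by blast
  then show ?thesis
    using assms y orbit_refl[of y] orbit_subset[OF y(1)] connected_orbit[of y] unfolding sides_def
    by (intro components_maximal[of S "U - orbit x"]) auto
qed

text \<open>A component of the complement of the orbit is relatively closed in that complement.\<close>
lemma boundary_of_side:
  assumes "S \<in> sides x" "y \<in> closure S" "y \<in> U" "y \<notin> S"
  shows "orbit y = orbit x"
proof (rule ccontr)
  assume "orbit y \<noteq> orbit x"
  then have y: "y \<in> U - orbit x"
    using assms(3) orbit_eq[of y x] by auto
  have "closedin (top_of_set (U - orbit x)) S"
    using assms(1) unfolding sides_def by (rule closedin_component)
  then obtain T where T: "closed T" "S = (U - orbit x) \<inter> T"
    by (auto simp: closedin_closed)
  then have "closure S \<subseteq> T"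
    by (intro closure_minimal) auto
  then show False
    using y T(2) assms(2,4) by blast
qed

lemma connected_Diff_side: "\<lbrakk>x \<in> U; S \<in> sides x\<rbrakk> \<Longrightarrow> connected (U - S)"
  unfolding sides_def by (rule component_diff_connected[OF connected_orbit U(2) orbit_subset])

text \<open>
This produces small sides: when \<open>W\<close> is the complement of a side, or a union of such complements, the
side obtained here lies in the given side, or in all of the given sides.
\<close>
lemma side_avoiding:
  assumes "connected W" "W \<subseteq> U - orbit y" "y \<in> U"
  obtains S where "S \<in> sides y" "S \<inter> W = {}"
proof -
  obtain C C' where C: "C \<in> sides y" "C' \<in> sides y" "C \<noteq> C'"
    using orbit_separates[OF assms(3), unfolded connected_eq_connected_components_eq] unfolding sides_def by auto
  show ?thesis
  proof (cases "C \<inter> W = {}")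
    case False
    then have "W \<subseteq> C"
      using components_maximal[of C "U - orbit y" W] assms C(1) unfolding sides_def by simp
    moreover have "C' \<inter> C = {}"
      using C components_nonoverlap[of C' "U - orbit y" C] unfolding sides_def by auto
    ultimately show ?thesis
      using that[OF C(2)] by blast
  qed (use that[OF C(1)] in blast)
qed

text \<open>
There can be no minimal side, but Zorn's lemma provides one. It is applied to the complements of sides in
\<open>U\<close>, which are connected and for which minimal becomes maximal.
\<close>
lemma contradiction: False
proof -
  define \<A> where "\<A> = {U - S | S x. x \<in> U \<and> S \<in> sides x}"
  have "\<exists>M\<in>\<A>. \<forall>W\<in>\<C>. W \<subseteq> M" if chain: "subset.chain \<A> \<C>" for \<C>
  proof (cases "\<exists>M\<in>\<C>. \<forall>W\<in>\<C>. W \<subseteq> M")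
    case True
    then show ?thesis
      using chain by (auto simp: subset.chain_def)
  next
    case no_max: False
    have \<C>: "\<C> \<subseteq> \<A>" "\<And>V W. \<lbrakk>V \<in> \<C>; W \<in> \<C>\<rbrakk> \<Longrightarrow> V \<subseteq> W \<or> W \<subseteq> V"
      using chain by (auto simp: subset_chain_def)
    have "\<exists>y\<in>U. \<forall>W\<in>\<C>. y \<in> closure (U - W)"
    proof (cases "\<C> = {}")
      case True
      then show ?thesis using U(4) by blast
    next
      case False
      have "\<Inter>((\<lambda>W. closure (U - W) \<inter> B) ` \<C>) \<noteq> {}"
      proof (rule compact_chain)
        have *: "compact D \<and> D \<noteq> {}" if D_in: "D \<in> (\<lambda>W. closure (U - W) \<inter> B) ` \<C>" for D
        proof -
          obtain S x where S: "x \<in> U" "S \<in> sides x" "D = closure (U - (U - S)) \<inter> B"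
            using D_in \<C>(1) by (auto simp: \<A>_def)
          have "S \<subseteq> U" "S \<noteq> {}"
            using side_subset[OF S(2)] S(2) in_components_nonempty unfolding sides_def by blast+
          then obtain z where z: "z \<in> S" "z \<in> U" and D: "D = closure S \<inter> B"
            using S(3) by (auto simp: double_diff)
          obtain t where "F t z \<in> B"
            using meets_B z by blast
          moreover have "F t z \<in> S"
            using orbit_subset_side[OF S(2) z(1)] by (auto simp: orbit_def)
          ultimately have "D \<noteq> {}"
            using closure_subset D by blast
          then show ?thesis
            using B D by (simp add: closed_Int_compact)
        qed
        show "{} \<notin> (\<lambda>W. closure (U - W) \<inter> B) ` \<C>"
          using * by blast
        show "compact D" if "D \<in> (\<lambda>W. closure (U - W) \<inter> B) ` \<C>" for D
          using *[OF that] by blast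
        fix V W assume "V \<in> (\<lambda>W. closure (U - W) \<inter> B) ` \<C> \<and> W \<in> (\<lambda>W. closure (U - W) \<inter> B) ` \<C>"
        then obtain V' W' where VW: "V' \<in> \<C>" "W' \<in> \<C>"
          "V = closure (U - V') \<inter> B" "W = closure (U - W') \<inter> B"
          by blast
        from \<C>(2)[OF VW(1,2)] show "V \<subseteq> W \<or> W \<subseteq> V"
        proof
          assume "V' \<subseteq> W'"
          then have "closure (U - W') \<subseteq> closure (U - V')"
            by (intro closure_mono) blast
          then show ?thesis using VW by blast
        next
          assume "W' \<subseteq> V'"
          then have "closure (U - V') \<subseteq> closure (U - W')"
            by (intro closure_mono) blast
          then show ?thesis using VW by blast
        qed
      qed
      then show ?thesis
        using B(2) False by blast
    qed
    then obtain y where y: "y \<in> U" "\<And>W. W \<in> \<C> \<Longrightarrow> y \<in> closure (U - W)"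
      by blast
    (* The chain has no largest member, so behind each of its sides there is a smaller one. Were y on the
       boundary of the larger one, it would also be on the boundary of the smaller one, and the two would
       be different sides of the same orbit, hence disjoint. *)
    have disj: "W \<subseteq> U - orbit y" if W: "W \<in> \<C>" for W
    proof -
      obtain S x where S: "W = U - S" "x \<in> U" "S \<in> sides x"
        using W \<C>(1) unfolding \<A>_def by blast
      obtain W' where W': "W' \<in> \<C>" "\<not> W' \<subseteq> W"
        using no_max W by blast
      then obtain S' x' where S': "W' = U - S'" "x' \<in> U" "S' \<in> sides x'"
        using \<C>(1) unfolding \<A>_def by blast
      have SU: "S \<subseteq> U" "S' \<subseteq> U" "S' \<noteq> {}"
        using side_subset[OF S(3)] side_subset[OF S'(3)] S'(3) in_components_nonempty
        unfolding sides_def by blast+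
      have less: "S' \<subset> S"
        using \<C>(2)[OF W W'(1)] W'(2) S(1) S'(1) SU by blast
      have cl: "y \<in> closure S" "y \<in> closure S'"
        using y(2)[OF W] y(2)[OF W'(1)] S(1) S'(1) SU by (simp_all add: double_diff)
      have "y \<in> S"
      proof (rule ccontr)
        assume "y \<notin> S"
        then have "orbit x = orbit x'"
          using boundary_of_side[OF S(3) cl(1) y(1)] boundary_of_side[OF S'(3) cl(2) y(1)] less by blast
        then have "S' = S"
          using components_nonoverlap[of S' "U - orbit x" S] S(3) S'(3) less SU unfolding sides_def by auto
        then show False
          using less by simp
      qed
      then show ?thesis
        using orbit_subset_side[OF S(3)] S(1) by blast
    qed
    have "connected W" if "W \<in> \<C>" for W
      using that \<C>(1) connected_Diff_side unfolding \<A>_def by blast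
    then have "connected (\<Union>\<C>)"
      using \<C>(2) by (rule connected_Union_chain)
    then obtain S where S: "S \<in> sides y" "S \<inter> \<Union>\<C> = {}"
      using side_avoiding[of "\<Union>\<C>" y] disj y(1) by blast
    show ?thesis
    proof (intro bexI[of _ "U - S"] ballI)
      show "U - S \<in> \<A>"
        using S(1) y(1) by (auto simp: \<A>_def)
      show "W \<subseteq> U - S" if "W \<in> \<C>" for W
        using disj[OF that] S(2) that by blast
    qed
  qed
  then have "\<exists>M\<in>\<A>. \<forall>W\<in>\<A>. M \<subseteq> W \<longrightarrow> W = M"
    by (rule subset_Zorn)
  then obtain M where M: "M \<in> \<A>" "\<And>W. \<lbrakk>W \<in> \<A>; M \<subseteq> W\<rbrakk> \<Longrightarrow> W = M"
    by blast
  obtain S x where S: "M = U - S" "x \<in> U" "S \<in> sides x"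
    using M(1) unfolding \<A>_def by blast
  have SU: "S \<subseteq> U" "S \<noteq> {}"
    using side_subset[OF S(3)] S(3) in_components_nonempty unfolding sides_def by blast+
  then obtain y where y: "y \<in> S" "y \<in> U"
    by blast
  have "M \<subseteq> U - orbit y"
    using orbit_subset_side[OF S(3) y(1)] S(1) by blast
  then obtain S' where S': "S' \<in> sides y" "S' \<inter> M = {}"
    using side_avoiding[of M y] connected_Diff_side[OF S(2,3)] S(1) y(2) by blast
  have "U - S' \<in> \<A>"
    using S'(1) y(2) by (auto simp: \<A>_def)
  moreover have "M \<subseteq> U - S'"
    using S'(2) S(1) by blast
  ultimately have "U - S' = M"
    using M(2) by blast
  moreover have "y \<in> U - S'"
    using side_subset[OF S'(1)] orbit_refl y(2) by blast
  ultimately show False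
    using y(1) S(1) by blast
qed

end

section \<open>Fixed points in the bounded complementary components\<close>

lemma flow_on_disc_has_fixed_point:
  fixes F :: "real \<Rightarrow> complex \<Rightarrow> complex"
  assumes "continuous_on UNIV (\<lambda>p. F (snd p) (fst p))"
    and "\<And>z. F 0 z = z" and "\<And>s t z. F t (F s z) = F (s + t) z"
    and "open U" "connected U" "bounded U" "U \<noteq> {}" "connected (- U)"
    and "\<And>z t. z \<in> U \<Longrightarrow> F t z \<in> U"
    and "compact B" "B \<subseteq> U" "\<And>z. z \<in> U \<Longrightarrow> \<exists>t. F t z \<in> B"
  shows "\<exists>z\<in>U. \<forall>t. F t z = z"
proof (rule ccontr)
  assume "\<not> ?thesis"
  then have "\<exists>t. F t z \<noteq> z" if "z \<in> U" for z
    using that by blast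
  then interpret fixed_point_free_disc_flow F U B
    by (intro fixed_point_free_disc_flow.intro assms)
  show False by (rule contradiction)
qed

text \<open>
Isolation enters only here, through the compact set \<open>B\<close>. The boundary of the component \<open>C\<close> lies in \<open>K\<close>, hence in the
interior of the isolating neighborhood, so \<open>B\<close> is a subset of \<open>C\<close>; and no orbit in \<open>C\<close> avoids \<open>B\<close>,
because \<open>K\<close> contains every invariant subset of the neighborhood.
\<close>
lemma bounded_component_contains_fixed_point:
  fixes \<phi> :: "'a::euclidean_space \<times> real \<Rightarrow> 'a"
  assumes dim: "DIM('a) = 2" and flow: "is_flow \<phi>"
    and iso: "isolated_invariant_set \<phi> K" and K: "continuum K"
    and C: "C \<in> components (- K)" "bounded C"
  shows "\<exists>x\<in>C. x \<in> fixed_points \<phi>"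
proof -
  have cont: "continuous_on UNIV \<phi>" and zero: "\<And>x. \<phi> (x, 0) = x"
    and add: "\<And>x s t. \<phi> (\<phi> (x, s), t) = \<phi> (x, s + t)"
    using flow by (auto simp: is_flow_def)
  obtain N where N: "isolating_neighborhood \<phi> K N"
    using iso by (auto simp: isolated_invariant_set_def)
  have "\<phi> ` (K \<times> UNIV) = K"
    using iso by (simp add: isolated_invariant_set_def flow_invariant_def)
  then have K_inv: "\<phi> (x, t) \<in> K" if "x \<in> K" for x t
    using that by blast
  have compl_inv: "\<phi> (x, t) \<notin> K" if "x \<notin> K" for x t
    using K_inv[of "\<phi> (x, t)" "- t"] that by (auto simp: add zero)
  have conn_orbit: "connected (range (\<lambda>t. \<phi> (x, t)))" for x
    by (intro connected_continuous_image continuous_on_compose2[OF cont] continuous_intros) auto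
  have C_sub: "C \<subseteq> - K" "C \<noteq> {}" "connected C"
    using in_components_subset[OF C(1)] in_components_nonempty[OF C(1)] in_components_connected[OF C(1)]
    by simp_all
  have "open C"
    by (rule open_components[OF _ C(1)]) (use K in \<open>simp add: continuum_def compact_imp_closed open_Compl\<close>)
  have "connected (- C)"
    using component_complement_connected[OF _ C(1)] K by (simp add: continuum_def)
  have C_inv: "\<phi> (x, t) \<in> C" if "x \<in> C" for x t
  proof -
    have "range (\<lambda>t. \<phi> (x, t)) \<subseteq> C"
    proof (rule components_maximal[OF C(1) conn_orbit])
      show "range (\<lambda>t. \<phi> (x, t)) \<subseteq> - K"
        using compl_inv that C_sub(1) by blast
      have "x \<in> range (\<lambda>t. \<phi> (x, t))"
        by (rule range_eqI[of _ _ 0]) (simp add: zero)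
      then show "C \<inter> range (\<lambda>t. \<phi> (x, t)) \<noteq> {}"
        using that by blast
    qed
    then show ?thesis by blast
  qed
  define B where "B = closure C - interior N"
  have "compact B"
    using C(2) unfolding B_def by (intro compact_diff) auto
  have "B \<subseteq> C"
  proof -
    obtain T where "closed T" "C = - K \<inter> T"
      using closedin_component[OF C(1)] by (auto simp: closedin_closed)
    then have "closure C \<subseteq> C \<union> K"
      using closure_minimal[of C T] by blast
    then show ?thesis
      using N by (auto simp: B_def isolating_neighborhood_def)
  qed
  have meets: "\<exists>t. \<phi> (x, t) \<in> B" if x: "x \<in> C" for x
  proof (rule ccontr)
    assume *: "\<nexists>t. \<phi> (x, t) \<in> B"
    let ?O = "range (\<lambda>t. \<phi> (x, t))"
    have "\<phi> (x, t) \<in> interior N" for t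
      using * C_inv[OF x, of t] closure_subset[of C] by (auto simp: B_def)
    then have "?O \<subseteq> N"
      using interior_subset by blast
    moreover have "flow_invariant \<phi> ?O"
      unfolding flow_invariant_def
    proof (intro subset_antisym subsetI)
      fix y assume "y \<in> ?O"
      then show "y \<in> \<phi> ` (?O \<times> UNIV)"
        by (intro image_eqI[of _ _ "(y, 0)"]) (auto simp: zero)
    qed (auto simp: add)
    ultimately have "?O \<subseteq> K"
      using N by (auto simp: isolating_neighborhood_def)
    then show False
      using compl_inv x C_sub(1) by blast
  qed
  have "DIM('a) = DIM(complex)"
    by (simp add: dim)
  then obtain f :: "'a \<Rightarrow> complex" and g where fg: "linear f" "linear g" "\<And>x. g (f x) = x" "\<And>y. f (g y) = y"
    using isomorphisms_UNIV_UNIV by metis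
  have contfg: "continuous_on S f" "continuous_on T g" for S T
    using fg by (simp_all add: linear_continuous_on linear_conv_bounded_linear)
  have fC: "f ` S = g -` S" for S
  proof (intro set_eqI iffI)
    fix y assume "y \<in> g -` S"
    then have "f (g y) \<in> f ` S"
      by simp
    then show "y \<in> f ` S"
      by (simp only: fg(4))
  qed (auto simp: fg(3))
  have "\<exists>z\<in>f ` C. \<forall>t. f (\<phi> (g z, t)) = z"
  proof (rule flow_on_disc_has_fixed_point)
    show "continuous_on UNIV (\<lambda>p. f (\<phi> (g (fst p), snd p)))"
      by (intro continuous_on_compose2[OF contfg(1)] continuous_on_compose2[OF cont]
          continuous_on_compose2[OF contfg(2)] continuous_intros) auto
    show "open (f ` C)"
      unfolding fC using \<open>open C\<close> contfg by (intro open_vimage)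
    show "connected (f ` C)"
      using C_sub contfg by (intro connected_continuous_image)
    show "bounded (f ` C)"
      using C(2) fg(1) by (simp add: bounded_linear_image linear_conv_bounded_linear)
    have "- (f ` C) = f ` (- C)"
      unfolding fC by auto
    then show "connected (- (f ` C))"
      using \<open>connected (- C)\<close> contfg by (simp add: connected_continuous_image)
    show "compact (f ` B)"
      using \<open>compact B\<close> contfg by (intro compact_continuous_image)
    show "f ` B \<subseteq> f ` C"
      using \<open>B \<subseteq> C\<close> by (rule image_mono)
    show "\<exists>t. f (\<phi> (g z, t)) \<in> f ` B" if z: "z \<in> f ` C" for z
    proof -
      obtain x where "x \<in> C" "z = f x"
        using z by blast
      then show ?thesis
        using meets[of x] fg(3) by auto
    qed
    show "f (\<phi> (g z, t)) \<in> f ` C" if "z \<in> f ` C" for z t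
      using that C_inv by (auto simp: fg(3))
  qed (simp_all add: fg(3,4) zero add C_sub(2))
  then obtain x where x: "x \<in> C" "\<And>t. f (\<phi> (g (f x), t)) = f x"
    by blast
  have "\<phi> (x, t) = x" for t
    using x(2)[of t] fg(3) by metis
  then show ?thesis
    using x(1) by (auto simp: fixed_points_def)
qed

text \<open>
Distinct components are disjoint, so the fixed points chosen in the bounded ones are distinct, and all
components except at most one are bounded.
\<close>
theorem corollary34:
  fixes \<phi> :: "(real ^ 2) \<times> real \<Rightarrow> real ^ 2" and K :: "(real ^ 2) set" and i :: nat
  assumes "is_flow \<phi>"
    and "isolated_invariant_set \<phi> K"
    and "continuum K"
    and "finite (components (- K))" and "card (components (- K)) = i"
  shows "\<exists>P. P \<subseteq> fixed_points \<phi> - K \<and> finite P \<and> card P = i - 1"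
proof -
  define \<B> where "\<B> = {C \<in> components (- K). bounded C}"
  have "\<exists>x. x \<in> C \<and> x \<in> fixed_points \<phi>" if "C \<in> \<B>" for C
    using bounded_component_contains_fixed_point[OF _ assms(1-3), of C] that by (auto simp: \<B>_def)
  then obtain p where p: "\<And>C. C \<in> \<B> \<Longrightarrow> p C \<in> C \<and> p C \<in> fixed_points \<phi>"
    by metis
  have "inj_on p \<B>"
  proof (rule inj_onI)
    fix C D assume CD: "C \<in> \<B>" "D \<in> \<B>" "p C = p D"
    then have "C \<inter> D \<noteq> {}"
      using p by (metis IntI empty_iff)
    then show "C = D"
      using CD components_nonoverlap[of C "- K" D] by (simp add: \<B>_def)
  qed
  have fin: "finite \<B>"
    using assms(4) by (simp add: \<B>_def)
  have "bounded K"
    using assms(3) by (simp add: continuum_def compact_imp_bounded)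
  then have "C = D" if "C \<in> components (- K) - \<B>" "D \<in> components (- K) - \<B>" for C D
    using cobounded_unique_unbounded_components[of "- K" D C] that by (auto simp: \<B>_def)
  then have "card (components (- K) - \<B>) \<le> 1"
    using card_le_Suc0_iff_eq[of "components (- K) - \<B>"] assms(4) by simp
  moreover have "card (components (- K) - \<B>) = i - card \<B>"
    using assms(5) fin by (simp add: card_Diff_subset \<B>_def)
  ultimately have "i - 1 \<le> card (p ` \<B>)"
    using card_image[OF \<open>inj_on p \<B>\<close>] by linarith
  then obtain P where P: "P \<subseteq> p ` \<B>" "card P = i - 1" "finite P"
    by (rule obtain_subset_with_card_n)
  have "p ` \<B> \<subseteq> fixed_points \<phi> - K"
  proof (intro image_subsetI)
    fix C assume C: "C \<in> \<B>"
    then have "C \<subseteq> - K"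
      using in_components_subset[of C "- K"] by (simp add: \<B>_def)
    then show "p C \<in> fixed_points \<phi> - K"
      using p[OF C] by blast
  qed
  then show ?thesis
    using P by (intro exI[of _ P]) (simp add: subset_trans)
qed

end
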